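(* Let $f:[0,1]\to[0,1]$ be given by $f(\Delta^{3}_{\alpha_1\alpha_2\ldots\alpha_n\ldots})=\Delta^{3}_{\varphi(\alpha_1)\varphi(\alpha_2)\ldots\varphi(\alpha_n)\ldots}$, where $\varphi(0)=0$, $\varphi(1)=2$, $\varphi(2)=1$. Then the Lebesgue integral of $f$ over $[0,1]$ is equal to $\frac{1}{2}$.
   Context: For digits $\alpha_n\in\{0,1,2\}$, $\Delta^{3}_{\alpha_1\alpha_2\ldots\alpha_n\ldots}$ denotes $\sum_{n=1}^{\infty}\alpha_n 3^{-n}$. Every $x\in[0,1]$ is written using its ternary representation that does not end in an infinite string of 2's, except that $1$ is written as $\Delta^{3}_{222\ldots}$; thus each $x$ has exactly one admissible digit sequence, and it is this sequence that is used in the definition of $f$. *)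

theory Defs
  imports "HOL-Analysis.Analysis"
begin

text \<open>Digit sequences are indexed from 0, so the digit \<open>a n\<close> carries weight \<open>3 ^ -(n + 1)\<close>.\<close>

definition ternary_value :: "(nat \<Rightarrow> nat) \<Rightarrow> real" where
  "ternary_value a = (\<Sum>n. real (a n) / 3 ^ Suc n)"

definition admissible_expansion :: "(nat \<Rightarrow> nat) \<Rightarrow> real \<Rightarrow> bool" where
  "admissible_expansion a x \<longleftrightarrow>
     range a \<subseteq> {0, 1, 2} \<and> ternary_value a = x \<and>
     (if x = 1 then \<forall>n. a n = 2 else \<not> (\<exists>N. \<forall>n\<ge>N. a n = 2))"

text \<open>Unique, hence meaningful, for \<open>x \<in> {0..1}\<close>; unspecified elsewhere.\<close>

definition ternary_digits :: "real \<Rightarrow> nat \<Rightarrow> nat" where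
  "ternary_digits x = (THE a. admissible_expansion a x)"

text \<open>Only the values at 0, 1 and 2 matter.\<close>

definition \<phi> :: "nat \<Rightarrow> nat" where
  "\<phi> d = (if d = 1 then 2 else if d = 2 then 1 else 0)"

definition digit_swap :: "real \<Rightarrow> real" where
  "digit_swap x = ternary_value (\<lambda>n. \<phi> (ternary_digits x n))"

end

theory Submission
  imports Defs
begin

text \<open>Off the endpoint 1, the map is the restriction of a 1-periodic bounded measurable function
  \<open>g\<close> built from the digits \<open>\<lfloor>3 ^ (n + 1) * x\<rfloor> mod 3\<close>. It satisfies \<open>g x = (\<phi> j + g (3 * x - j)) / 3\<close>
  on \<open>[j / 3, (j + 1) / 3)\<close> for \<open>j = 0, 1, 2\<close>. Integrating over the three thirds gives
  \<open>I = (\<phi> 0 + \<phi> 1 + \<phi> 2 + 3 * I) / 9 = (1 + I) / 3\<close>, whence \<open>I = 1 / 2\<close>.\<close>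

section \<open>Ternary series with digits at most 2\<close>

lemma summable_ternary:
  assumes "\<And>n. a n \<le> 2"
  shows "summable (\<lambda>n. real (a n) / 3 ^ Suc n)"
proof (rule summable_comparison_test')
  show "summable (\<lambda>n. (1/3::real) ^ n)" by (simp add: summable_geometric)
  show "norm (real (a n) / 3 ^ Suc n) \<le> (1/3) ^ n" for n
    using assms[of n] by (simp add: field_simps)
qed

lemma ternary_value_split:
  assumes "\<And>n. a n \<le> 2"
  shows "ternary_value a = (real (a 0) + ternary_value (\<lambda>n. a (Suc n))) / 3"
proof -
  have "ternary_value a = real (a 0) / 3 + (\<Sum>n. real (a (Suc n)) / 3 ^ Suc (Suc n))"
    using suminf_split_head[OF summable_ternary[of a, OF assms]] by (simp add: ternary_value_def)
  also have "(\<Sum>n. real (a (Suc n)) / 3 ^ Suc (Suc n)) = (\<Sum>n. (real (a (Suc n)) / 3 ^ Suc n) / 3)"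
    by (intro suminf_cong) simp
  also have "\<dots> = ternary_value (\<lambda>n. a (Suc n)) / 3"
    unfolding ternary_value_def
    by (rule suminf_divide) (rule summable_ternary, rule assms)
  finally show ?thesis by simp
qed

lemma ternary_value_nonneg: "0 \<le> ternary_value a" if "\<And>n. a n \<le> 2"
  unfolding ternary_value_def by (rule suminf_nonneg[OF summable_ternary]) (use that in auto)

lemma ternary_value_le_1:
  assumes "\<And>n. a n \<le> 2"
  shows "ternary_value a \<le> 1"
proof -
  \<comment> \<open>The extreme case has every digit equal to 2, and its geometric series sums to
    exactly 1.\<close>
  have "(\<lambda>n. 2/3 * (1/3::real) ^ n) sums (2/3 * (1 / (1 - 1/3)))"
    by (intro sums_mult geometric_sums) simp
  then have s: "(\<lambda>n. 2 / (3::real) ^ Suc n) sums 1"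
    by (simp add: field_simps)
  have "ternary_value a \<le> (\<Sum>n. 2 / (3::real) ^ Suc n)"
    unfolding ternary_value_def
    by (intro suminf_le summable_ternary sums_summable[OF s] divide_right_mono)
       (use assms in \<open>auto simp: of_nat_le_iff[of _ 2, simplified]\<close>)
  also have "\<dots> = 1" using s by (rule sums_unique[symmetric])
  finally show ?thesis .
qed

text \<open>A single digit below 2 already costs a positive amount: induction on its position peels
  off leading digits until it comes first, where the tail bound 1 suffices. This keeps tails of
  admissible expansions out of the integer part.\<close>

lemma ternary_value_less_1:
  assumes "\<And>n. a n \<le> 2" and "a k < 2"
  shows "ternary_value a < 1"
  using assms
proof (induction k arbitrary: a)
  case 0
  have "ternary_value (\<lambda>n. a (Suc n)) \<le> 1" by (rule ternary_value_le_1) (rule 0)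
  moreover have "a 0 \<le> 1" using 0(2) by simp
  ultimately show ?case using ternary_value_split[of a, OF 0(1)] by simp
next
  case (Suc k)
  have "ternary_value (\<lambda>n. a (Suc n)) < 1" by (rule Suc.IH) (use Suc.prems in auto)
  moreover have "a 0 \<le> 2" by (rule Suc.prems)
  ultimately show ?case using ternary_value_split[of a, OF Suc.prems(1)] by simp
qed

section \<open>Digits read off by floors\<close>

definition floor_digit :: "real \<Rightarrow> nat \<Rightarrow> nat" where
  "floor_digit x n = nat (\<lfloor>3 ^ Suc n * x\<rfloor> mod 3)"

lemma floor_digit_le [simp]: "floor_digit x n \<le> 2"
  unfolding floor_digit_def by linarith

lemma floor_mult_3: "\<lfloor>3 * y\<rfloor> = 3 * \<lfloor>y\<rfloor> + \<lfloor>3 * y\<rfloor> mod 3" for y :: real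
proof -
  have "\<lfloor>3 * y\<rfloor> div 3 = \<lfloor>y\<rfloor>"
    using floor_divide_real_eq_div[of 3 "3 * y"] by simp
  then show ?thesis using mult_div_mod_eq[of 3 "\<lfloor>3 * y\<rfloor>"] by simp
qed

text \<open>Tripling pushes the leading digit of the fractional part across the ternary point. This
  recursion drives both the convergence of the floor digits and the exclusion of trailing
  2s.\<close>

lemma frac_mult_3: "frac (3 ^ Suc n * x) = 3 * frac (3 ^ n * x) - real (floor_digit x n)" for x :: real
proof -
  have "int (floor_digit x n) = \<lfloor>3 * (3 ^ n * x)\<rfloor> mod 3"
    by (simp add: floor_digit_def mult.assoc)
  then have "\<lfloor>3 * (3 ^ n * x)\<rfloor> = 3 * \<lfloor>3 ^ n * x\<rfloor> + int (floor_digit x n)"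
    using floor_mult_3[of "3 ^ n * x"] by linarith
  then show ?thesis unfolding frac_def power_Suc mult.assoc by simp
qed

lemma ternary_value_floor_digit: "ternary_value (floor_digit x) = frac x"
proof -
  \<comment> \<open>The sum telescopes: after \<open>n\<close> digits the remainder is the
    fractional part of \<open>3 ^ n * x\<close>, scaled back.\<close>
  have partial: "(\<Sum>k<n. real (floor_digit x k) / 3 ^ Suc k) = frac x - frac (3 ^ n * x) / 3 ^ n" for n
  proof (induction n)
    case (Suc n)
    have "3 * frac (3 ^ n * x) = frac (3 ^ Suc n * x) + real (floor_digit x n)"
      using frac_mult_3[of n x] by linarith
    moreover have "frac (3 ^ n * x) / 3 ^ n = 3 * frac (3 ^ n * x) / 3 ^ Suc n" by simp
    ultimately have "frac (3 ^ n * x) / 3 ^ n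
        = frac (3 ^ Suc n * x) / 3 ^ Suc n + real (floor_digit x n) / 3 ^ Suc n"
      by (simp only: add_divide_distrib)
    with Suc show ?case
      by (simp only: sum.lessThan_Suc diff_diff_eq[symmetric] diff_add_cancel)
  qed simp
  have "(\<lambda>n. frac (3 ^ n * x) / 3 ^ n) \<longlonglongrightarrow> 0"
  proof (rule tendsto_0_le[where K = 1])
    show "(\<lambda>n. (1/3::real) ^ n) \<longlonglongrightarrow> 0" by (rule LIMSEQ_power_zero) simp
    have "\<bar>frac (3 ^ n * x)\<bar> / 3 ^ n \<le> 1 / 3 ^ n" for n
      using frac_ge_0[of "3 ^ n * x"] frac_lt_1[of "3 ^ n * x"] by (intro divide_right_mono) auto
    then show "\<forall>\<^sub>F n in sequentially. norm (frac (3 ^ n * x) / 3 ^ n) \<le> norm ((1/3::real) ^ n) * 1"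
      by (intro always_eventually allI) (simp add: power_one_over)
  qed
  then have "(\<lambda>n. real (floor_digit x n) / 3 ^ Suc n) sums (frac x - 0)"
    unfolding sums_def partial by (intro tendsto_diff tendsto_const)
  then show ?thesis by (simp add: ternary_value_def sums_iff)
qed

text \<open>If all digits from \<open>N\<close> on were 2, then \<open>1 - frac (3 ^ n * x)\<close> would triple at every
  step from \<open>N\<close> on.\<close>
lemma floor_digit_not_eventually_2: "\<not> (\<forall>n\<ge>N. floor_digit x n = 2)"
proof
  assume *: "\<forall>n\<ge>N. floor_digit x n = 2"
  define d where "d = 1 - frac (3 ^ N * x)"
  have d: "d > 0" by (simp add: d_def frac_lt_1)
  have pow: "1 - frac (3 ^ (N + n) * x) = 3 ^ n * d" for n
  proof (induction n)
    case 0
    then show ?case by (simp add: d_def)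
  next
    case (Suc n)
    have "floor_digit x (N + n) = 2" using * by simp
    then show ?case using frac_mult_3[of "N + n" x] Suc by simp
  qed
  obtain n where n: "1 / d < 3 ^ n" using real_arch_pow[of 3 "1 / d"] by auto
  then have "1 < 3 ^ n * d" using d by (simp add: field_simps)
  then show False using pow[of n] frac_ge_0[of "3 ^ (N + n) * x"] by linarith
qed

section \<open>Existence and uniqueness of admissible expansions\<close>

lemma admissible_floor_digit:
  assumes "0 \<le> x" "x < 1"
  shows "admissible_expansion (floor_digit x) x"
proof -
  have "floor_digit x n \<in> {0, 1, 2}" for n
    using floor_digit_le[of x n] unfolding insert_iff empty_iff by linarith
  then have "range (floor_digit x) \<subseteq> {0, 1, 2}" by (rule image_subsetI)
  moreover have "frac x = x" using assms by (simp add: frac_eq)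
  ultimately show ?thesis
    using assms floor_digit_not_eventually_2
    by (auto simp: admissible_expansion_def ternary_value_floor_digit)
qed

text \<open>Multiplying by \<open>3 ^ Suc k\<close> turns the digits up to position \<open>k\<close>
  into an integer congruent to \<open>a k\<close> modulo 3 and leaves a tail in [0,1). The floor
  removes the tail, so the digit is forced.\<close>

lemma admissible_unique:
  assumes "admissible_expansion a x" "x < 1"
  shows "a = floor_digit x"
proof
  fix k
  have a: "a n \<le> 2" for n
  proof -
    have "a n \<in> {0, 1, 2}" using assms(1) unfolding admissible_expansion_def by blast
    then show ?thesis by auto
  qed
  have tail: "\<lfloor>ternary_value (\<lambda>n. a (n + k))\<rfloor> = 0" for k
  proof -
    \<comment> \<open>The ban on trailing 2s enters here: every tail contains a digit below 2, so
      its value stays strictly below 1.\<close>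
    have "\<exists>n\<ge>k. a n \<noteq> 2" using assms by (auto simp: admissible_expansion_def)
    then obtain n where "a (n + k) \<noteq> 2" by (metis le_add_diff_inverse2)
    then have "a (n + k) < 2" using a[of "n + k"] by linarith
    then have "ternary_value (\<lambda>n. a (n + k)) < 1"
      using ternary_value_less_1[of "\<lambda>n. a (n + k)" n] a by simp
    moreover have "0 \<le> ternary_value (\<lambda>n. a (n + k))" by (rule ternary_value_nonneg) (rule a)
    ultimately show ?thesis by linarith
  qed
  have step: "3 * ternary_value (\<lambda>n. a (n + k)) = real (a k) + ternary_value (\<lambda>n. a (n + Suc k))" for k
    using ternary_value_split[of "\<lambda>n. a (n + k)"] a by simp
  have shift_Suc: "3 ^ Suc k * x = of_int (3 * m + int (a k)) + ternary_value (\<lambda>n. a (n + Suc k))"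
    if "3 ^ k * x = of_int m + ternary_value (\<lambda>n. a (n + k))" for k m
  proof -
    have "3 ^ Suc k * x = 3 * (of_int m + ternary_value (\<lambda>n. a (n + k)))"
      unfolding that[symmetric] by simp
    then show ?thesis unfolding distrib_left step by simp
  qed
  have shift: "\<exists>m::int. 3 ^ k * x = of_int m + ternary_value (\<lambda>n. a (n + k))" for k
  proof (induction k)
    case 0
    have "ternary_value a = x" using assms(1) by (simp only: admissible_expansion_def)
    then show ?case by (intro exI[of _ 0]) simp
  next
    case (Suc k)
    then obtain m where "3 ^ k * x = of_int m + ternary_value (\<lambda>n. a (n + k))" by blast
    then show ?case using shift_Suc by blast
  qed
  from shift[of k] obtain m :: int
    where "3 ^ k * x = of_int m + ternary_value (\<lambda>n. a (n + k))" by blast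
  from shift_Suc[OF this] have "\<lfloor>3 ^ Suc k * x\<rfloor> = 3 * m + int (a k)"
    by (simp only: int_add_floor[symmetric] tail add_0_right)
  then have "floor_digit x k = nat ((3 * m + int (a k)) mod 3)"
    by (simp only: floor_digit_def)
  also have "\<dots> = a k" using a[of k] by simp
  finally show "a k = floor_digit x k" ..
qed

text \<open>This trades the definite description for an explicit formula whose measurability in
  \<open>x\<close> can be checked.\<close>

lemma ternary_digits_eq:
  assumes "0 \<le> x" "x < 1"
  shows "ternary_digits x = floor_digit x"
  unfolding ternary_digits_def
  using assms admissible_floor_digit admissible_unique by (intro the_equality) auto

section \<open>The swapped function and its self-similarity\<close>

definition periodic_swap :: "real \<Rightarrow> real" where
  "periodic_swap x = ternary_value (\<lambda>n. \<phi> (floor_digit x n))"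

lemma phi_le [simp]: "\<phi> d \<le> 2" by (simp add: \<phi>_def)

lemma digit_swap_eq: "digit_swap x = periodic_swap x" if "0 \<le> x" "x < 1"
  using that by (simp add: digit_swap_def periodic_swap_def ternary_digits_eq)

lemma periodic_swap_bounds: "0 \<le> periodic_swap x" "periodic_swap x \<le> 1"
  unfolding periodic_swap_def by (simp_all add: ternary_value_nonneg ternary_value_le_1)

lemma periodic_swap_measurable [measurable]: "periodic_swap \<in> borel_measurable borel"
proof -
  have [measurable]: "(\<lambda>x. floor_digit x n) \<in> borel \<rightarrow>\<^sub>M count_space UNIV" for n
    unfolding floor_digit_def by measurable
  show ?thesis
    unfolding periodic_swap_def ternary_value_def by measurable
qed

text \<open>On this third the leading digit is \<open>j\<close>, and the later digits of
  \<open>x\<close> are those of \<open>3 * x - j\<close>. The right end is excluded because the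
  leading digit changes there.\<close>

lemma periodic_swap_third:
  assumes "real j / 3 \<le> x" "x < (real j + 1) / 3" "j \<le> 2"
  shows "periodic_swap x = (real (\<phi> j) + periodic_swap (3 * x - real j)) / 3"
proof -
  have "\<lfloor>3 * x\<rfloor> = int j" using assms by (simp add: floor_eq_iff)
  then have head: "floor_digit x 0 = j" using assms(3) by (simp add: floor_digit_def)
  have "floor_digit x (Suc n) = floor_digit (3 * x - real j) n" for n
  proof -
    \<comment> \<open>The subtracted integer is written with an explicit factor 3, so that it
      visibly vanishes modulo 3 once the floor is taken.\<close>
    have "3 ^ Suc n * (3 * x - real j) = 3 ^ Suc (Suc n) * x - of_int (3 * (3 ^ n * int j))"
      by (simp add: algebra_simps)
    then have "\<lfloor>3 ^ Suc n * (3 * x - real j)\<rfloor> = \<lfloor>3 ^ Suc (Suc n) * x\<rfloor> - 3 * (3 ^ n * int j)"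
      by (metis floor_diff_of_int)
    then have "\<lfloor>3 ^ Suc n * (3 * x - real j)\<rfloor> mod 3 = \<lfloor>3 ^ Suc (Suc n) * x\<rfloor> mod 3"
      by presburger
    then show ?thesis by (simp only: floor_digit_def)
  qed
  then show ?thesis
    using ternary_value_split[of "\<lambda>n. \<phi> (floor_digit x n)"] head
    by (simp add: periodic_swap_def)
qed

section \<open>Evaluation of the integral\<close>

lemma periodic_swap_integrable: "periodic_swap absolutely_integrable_on {0..1}"
proof (rule measurable_bounded_by_integrable_imp_absolutely_integrable)
  have "periodic_swap \<in> borel_measurable lebesgue"
    by (intro measurable_completion) simp
  then show "periodic_swap \<in> borel_measurable (lebesgue_on {0..1})"
    by (rule measurable_restrict_space1)
  show "(\<lambda>_. 1::real) integrable_on {0..1::real}" by (rule integrable_const_ivl)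
  show "norm (periodic_swap x) \<le> 1" for x using periodic_swap_bounds[of x] by simp
qed simp

text \<open>The 9 combines the factor 1/3 from the substitution \<open>3 * x - j\<close> (for the
  constant term, the length of the interval) with the division by 3 in the self-similarity.\<close>

lemma periodic_swap_integral_third:
  assumes "(periodic_swap has_integral I) {0..1}" "j \<le> 2"
  shows "(periodic_swap has_integral (real (\<phi> j) + I) / 9) {real j / 3..(real j + 1) / 3}"
proof -
  \<comment> \<open>The left side has the form in which \<open>has_integral_affinity\<close>
    produces the new interval for slope 3 and offset \<open>- j\<close>.\<close>
  have img: "(\<lambda>x. (1/3) *\<^sub>R x + - ((1/3) *\<^sub>R (- real j))) ` {0..1} = {real j / 3..(real j + 1) / 3}"
    unfolding real_scaleR_def by (subst image_affinity_atLeastAtMost) (simp add: add_divide_distrib)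
  have "((\<lambda>x. periodic_swap (3 * x - real j)) has_integral I / 3) {real j / 3..(real j + 1) / 3}"
    using has_integral_affinity[of periodic_swap I 0 1 3 "- real j"] assms(1) img
    by (simp add: field_simps)
  moreover have "((\<lambda>x. real (\<phi> j)) has_integral real (\<phi> j) / 3) {real j / 3..(real j + 1) / 3}"
    using has_integral_const_real[of "real (\<phi> j)" "real j / 3" "(real j + 1) / 3"]
    by (simp add: field_simps)
  ultimately have "((\<lambda>x. (real (\<phi> j) + periodic_swap (3 * x - real j)) / 3)
      has_integral (real (\<phi> j) / 3 + I / 3) / 3) {real j / 3..(real j + 1) / 3}"
    by (intro has_integral_divide has_integral_add)
  \<comment> \<open>The self-similarity is available only on the half-open third, so the right
    endpoint is discarded as a finite exceptional set.\<close>
  then have "(periodic_swap has_integral (real (\<phi> j) / 3 + I / 3) / 3) {real j / 3..(real j + 1) / 3}"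
    by (rule has_integral_spike_finite[of "{(real j + 1) / 3}", rotated 2])
       (use periodic_swap_third[of j] assms(2) in auto)
  then show ?thesis by (simp add: field_simps)
qed

lemma integral_periodic_swap: "integral {0..1} periodic_swap = 1 / 2"
proof -
  define I where "I = integral {0..1} periodic_swap"
  \<comment> \<open>Existence of the integral comes first; the linear equation for \<open>I\<close>
    then determines its value.\<close>
  have I: "(periodic_swap has_integral I) {0..1}"
    unfolding I_def
    by (intro integrable_integral set_lebesgue_integral_eq_integral(1) periodic_swap_integrable)
  note third = periodic_swap_integral_third[OF I]
  have "(periodic_swap has_integral I / 9) {0..1/3}"
    using third[of 0] by (simp add: \<phi>_def)
  moreover have "(periodic_swap has_integral (2 + I) / 9) {1/3..2/3}"
    using third[of 1] by (simp add: \<phi>_def)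
  ultimately have "(periodic_swap has_integral I / 9 + (2 + I) / 9) {0..2/3}"
    by (intro has_integral_combine[of 0 "1/3" "2/3"]) auto
  moreover have "(periodic_swap has_integral (1 + I) / 9) {2/3..1}"
    using third[of 2] by (simp add: \<phi>_def)
  ultimately have "(periodic_swap has_integral I / 9 + (2 + I) / 9 + (1 + I) / 9) {0..1}"
    by (intro has_integral_combine[of 0 "2/3" 1]) auto
  with I have "I = I / 9 + (2 + I) / 9 + (1 + I) / 9"
    by (rule has_integral_unique)
  then have "9 * I = I + (2 + I) + (1 + I)" by (simp add: field_simps)
  then have "I = 1 / 2" by linarith
  then show ?thesis by (simp add: I_def)
qed

theorem theorem6:
  shows "set_integrable lebesgue {0..1} digit_swap \<and>
         set_lebesgue_integral lebesgue {0..1} digit_swap = 1 / 2"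
proof
  \<comment> \<open>The point 1 is a genuine exception: its all-2 expansion gives
    \<open>digit_swap 1 = 1 / 2\<close>, while its floor digits are all 0 and
    \<open>periodic_swap 1 = 0\<close>.\<close>
  have eq: "digit_swap x = periodic_swap x" if "x \<in> {0..1} - {1}" for x
    using that by (auto intro: digit_swap_eq)
  show int: "set_integrable lebesgue {0..1} digit_swap"
    by (rule absolutely_integrable_spike[OF periodic_swap_integrable, of "{1}"]) (use eq in auto)
  have "set_lebesgue_integral lebesgue {0..1} digit_swap = integral {0..1} digit_swap"
    by (rule set_lebesgue_integral_eq_integral(2)[OF int])
  also have "\<dots> = integral {0..1} periodic_swap"
    by (rule integral_spike[of "{1}"]) (use eq in auto)
  finally show "set_lebesgue_integral lebesgue {0..1} digit_swap = 1 / 2"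
    by (simp add: integral_periodic_swap)
qed

end
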